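(* Let $G$ and $H$ be connected graphs. Then \[ Z(G\vee H)=\min\{|V(H)|+Z(G),\ |V(G)|+Z(H)\}. \]
   Context: All graphs are finite, simple and undirected. Zero forcing: vertices are coloured black or white; if a black vertex $u$ has exactly one white neighbour $v$, then $v$ is recoloured black. A set $Z\subseteq V(G)$ is a zero forcing set if, starting with $Z$ black and all other vertices white, repeated application of this rule colours all vertices black; $Z(G)$ is the minimum size of a zero forcing set. The join $G\vee H$ is the disjoint union of $G$ and $H$ together with all edges $gh$ with $g\in V(G)$, $h\in V(H)$.
   Formalization: The case where G and H are both a single vertex is excluded, because the formula fails there: Z(K_1 ∨ K_1) = Z(K_2) = 1, while both |V(H)|+Z(G) and |V(G)|+Z(H) equal 2. *)

theory Defs
  imports "Graph_Theory.Digraph_Component"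
begin

text \<open>
  A finite simple undirected graph is a \<^locale>\<open>pair_graph\<close>: finite, loop-free, and with a
  symmetric arc relation, so that each edge \<open>uv\<close> is represented by both arcs \<open>(u, v)\<close> and
  \<open>(v, u)\<close>. The predicate \<^const>\<open>connected\<close> of the library requires at least one vertex.
\<close>

definition graph_join :: "'a pair_pre_digraph \<Rightarrow> 'b pair_pre_digraph \<Rightarrow> ('a + 'b) pair_pre_digraph"
  where "graph_join G H =
    \<lparr> pverts = pverts G <+> pverts H,
      parcs = {(Inl u, Inl v) | u v. (u, v) \<in> parcs G}
            \<union> {(Inr u, Inr v) | u v. (u, v) \<in> parcs H}
            \<union> {(Inl g, Inr h) | g h. g \<in> pverts G \<and> h \<in> pverts H}
            \<union> {(Inr h, Inl g) | g h. g \<in> pverts G \<and> h \<in> pverts H} \<rparr>"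

lemma pair_graph_graph_join:
  assumes "pair_graph G" "pair_graph H"
  shows "pair_graph (graph_join G H)"
proof -
  interpret G: pair_graph G by fact
  interpret H: pair_graph H by fact
  have fin: "finite (pverts (graph_join G H))"
    by (simp add: graph_join_def)
  have sub: "parcs (graph_join G H) \<subseteq> pverts (graph_join G H) \<times> pverts (graph_join G H)"
    by (auto simp: graph_join_def dest: G.in_arcsD1 G.in_arcsD2 H.in_arcsD1 H.in_arcsD2)
  have "finite (parcs (graph_join G H))"
    using fin sub by (meson finite_SigmaI finite_subset)
  moreover have "symmetric (with_proj (graph_join G H))"
    using G.pair_sym_arcs H.pair_sym_arcs
    by (auto simp: symmetric_def graph_join_def sym_def)
  moreover have "fst e \<noteq> snd e" if "e \<in> parcs (graph_join G H)" for e
    using that by (auto simp: graph_join_def dest: G.pair_no_loops H.pair_no_loops)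
  ultimately show ?thesis
    using fin sub by unfold_locales auto
qed

text \<open>\<open>colour_change G S T\<close>: one application of the rule turns the black set \<open>S\<close> into \<open>T\<close>.\<close>

inductive colour_change :: "'a pair_pre_digraph \<Rightarrow> 'a set \<Rightarrow> 'a set \<Rightarrow> bool"
  for G :: "'a pair_pre_digraph" where
  "u \<in> S \<Longrightarrow> {w \<in> pverts G. (u, w) \<in> parcs G \<and> w \<notin> S} = {v} \<Longrightarrow> colour_change G S (insert v S)"

definition zero_forcing_set :: "'a pair_pre_digraph \<Rightarrow> 'a set \<Rightarrow> bool" where
  "zero_forcing_set G Z \<longleftrightarrow> Z \<subseteq> pverts G \<and> (colour_change G)\<^sup>*\<^sup>* Z (pverts G)"

definition zero_forcing_number :: "'a pair_pre_digraph \<Rightarrow> nat" where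
  "zero_forcing_number G = Min {card Z | Z. zero_forcing_set G Z}"

text \<open>
  The formula for the zero forcing number of a join of connected graphs fails for exactly one
  pair: if both graphs are a single vertex, the join is \<open>K\<^sub>2\<close>, whose zero forcing number is
  1, while both candidate values are 2. This pair has to be excluded.
\<close>

end

theory Submission
  imports Defs
begin

text \<open>
  A set \<open>Z\<close> is zero forcing iff the process cannot stall at any \<open>S\<close> with \<open>Z \<subseteq> S \<subset> V\<close>. The upper
  bound colours all of one side together with a zero forcing set of the other. For the lower
  bound, look at the first force in the join, made by \<open>a \<in> V(G)\<close>, say, with \<open>G\<close> having at least
  two vertices. If it forces into \<open>G\<close>, then all of \<open>H\<close> is already black, and the black vertices of
  \<open>G\<close> form a zero forcing set of \<open>G\<close>: a force by a vertex of \<open>H\<close> only ever colours the last white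
  vertex of \<open>G\<close>, which any of its neighbours in \<open>G\<close> could have coloured. If it forces \<open>v \<in> V(H)\<close>,
  then \<open>a\<close> and its neighbours in \<open>G\<close> are all black, so one such neighbour may be traded for \<open>v\<close>.
  If \<open>G\<close> is the single vertex \<open>a\<close>, then only \<open>v\<close> was white, and \<open>V(H) - {v}\<close> is zero forcing in \<open>H\<close>.
\<close>

section \<open>Zero forcing sets characterised by the absence of stalled states\<close>

lemma zero_forcing_set_iff:
  assumes "finite (pverts G)"
  shows "zero_forcing_set G Z \<longleftrightarrow> Z \<subseteq> pverts G \<and>
    (\<forall>S. Z \<subseteq> S \<and> S \<subset> pverts G \<longrightarrow>
      (\<exists>u\<in>S. \<exists>v. {w \<in> pverts G. (u, w) \<in> parcs G \<and> w \<notin> S} = {v}))"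
    (is "_ \<longleftrightarrow> _ \<and> (\<forall>S. _ \<longrightarrow> ?force S)")
proof (intro iffI conjI allI impI)
  assume "zero_forcing_set G Z"
  then show "Z \<subseteq> pverts G"
    by (simp add: zero_forcing_set_def)
next
  fix S
  assume zf: "zero_forcing_set G Z" and S: "Z \<subseteq> S \<and> S \<subset> pverts G"
  show "?force S"
  proof (rule ccontr)
    assume stalled: "\<not> ?force S"
    have "(colour_change G)\<^sup>*\<^sup>* Z (pverts G)"
      using zf by (simp add: zero_forcing_set_def)
    \<comment> \<open>Every set reached from \<open>Z\<close> stays inside the stalled
      \<open>S\<close>: if \<open>T \<subseteq> S\<close> and \<open>T\<close> forces some
      \<open>v \<notin> S\<close>, then \<open>v\<close> is also the only white neighbour relative
      to \<open>S\<close>, so \<open>S\<close> could force it.\<close>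
    then have "pverts G \<subseteq> S"
    proof (induction rule: rtranclp_induct)
      case base
      then show ?case using S by simp
    next
      case (step T T')
      from step.hyps(2) show ?case
      proof cases
        case (1 u v)
        have "v \<in> S"
        proof (rule ccontr)
          assume "v \<notin> S"
          then have "{w \<in> pverts G. (u, w) \<in> parcs G \<and> w \<notin> S} = {v}"
            using 1 step.IH by blast
          then show False
            using stalled 1 step.IH by blast
        qed
        then show ?thesis using 1 step.IH by simp
      qed
    qed
    then show False using S by blast
  qed
next
  assume "Z \<subseteq> pverts G \<and> (\<forall>S. Z \<subseteq> S \<and> S \<subset> pverts G \<longrightarrow> ?force S)"
  then have sub: "Z \<subseteq> pverts G" and force: "\<And>S. Z \<subseteq> S \<Longrightarrow> S \<subset> pverts G \<Longrightarrow> ?force S"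
    by blast+
  \<comment> \<open>The claim covers every set between \<open>Z\<close> and the vertex set, so that
    induction on the number of white vertices can start with any available force.\<close>
  have "(colour_change G)\<^sup>*\<^sup>* S (pverts G)" if "Z \<subseteq> S" "S \<subseteq> pverts G" for S
    using that
  proof (induction "card (pverts G - S)" arbitrary: S rule: less_induct)
    case less
    show ?case
    proof (cases "S = pverts G")
      case False
      then obtain u v where uv: "u \<in> S" "{w \<in> pverts G. (u, w) \<in> parcs G \<and> w \<notin> S} = {v}"
        using force[of S] less.prems by blast
      have v: "v \<in> pverts G" "v \<notin> S"
        using uv by blast+
      have "card (pverts G - insert v S) < card (pverts G - S)"
        using v assms by (intro psubset_card_mono) auto
      then have "(colour_change G)\<^sup>*\<^sup>* (insert v S) (pverts G)"
        using less v by (metis insert_subset subset_insertI2)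
      then show ?thesis
        using colour_change.intros[OF uv] by (rule converse_rtranclp_into_rtranclp[rotated])
    qed simp
  qed
  then show "zero_forcing_set G Z"
    using sub by (simp add: zero_forcing_set_def)
qed

lemma zero_forcing_setI:
  assumes "finite (pverts G)" "Z \<subseteq> pverts G"
    and "\<And>S. Z \<subseteq> S \<Longrightarrow> S \<subset> pverts G \<Longrightarrow>
      \<exists>u\<in>S. \<exists>v. {w \<in> pverts G. (u, w) \<in> parcs G \<and> w \<notin> S} = {v}"
  shows "zero_forcing_set G Z"
  using assms by (simp add: zero_forcing_set_iff)

lemma zero_forcing_setE:
  assumes "finite (pverts G)" "zero_forcing_set G Z" "Z \<subseteq> S" "S \<subset> pverts G"
  obtains u v where "u \<in> S" "{w \<in> pverts G. (u, w) \<in> parcs G \<and> w \<notin> S} = {v}"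
  using assms unfolding zero_forcing_set_iff[OF assms(1)] by blast

lemma zero_forcing_set_pverts: "zero_forcing_set G (pverts G)"
  by (simp add: zero_forcing_set_def)

text \<open>The no-stalling condition for \<open>Y\<close> ranges over fewer sets \<open>S\<close>
  than the one for \<open>Z\<close>, so no run has to be replayed from the larger start.\<close>

lemma zero_forcing_set_mono:
  assumes "finite (pverts G)" "zero_forcing_set G Z" "Z \<subseteq> Y" "Y \<subseteq> pverts G"
  shows "zero_forcing_set G Y"
proof (rule zero_forcing_setI)
  fix S assume "Y \<subseteq> S" "S \<subset> pverts G"
  then obtain u v where "u \<in> S" "{w \<in> pverts G. (u, w) \<in> parcs G \<and> w \<notin> S} = {v}"
    using zero_forcing_setE[OF assms(1,2) subset_trans[OF assms(3)]] by blast
  then show "\<exists>u\<in>S. \<exists>v. {w \<in> pverts G. (u, w) \<in> parcs G \<and> w \<notin> S} = {v}" by blast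
qed (use assms in simp_all)

section \<open>The zero forcing number as an attained minimum\<close>

lemma finite_zero_forcing_cards:
  assumes "finite (pverts G)"
  shows "finite {card Z | Z. zero_forcing_set G Z}"
proof -
  have "{card Z | Z. zero_forcing_set G Z} \<subseteq> card ` Pow (pverts G)"
    by (auto simp: zero_forcing_set_def)
  then show ?thesis using assms by (meson finite_Pow_iff finite_imageI finite_subset)
qed

lemma zero_forcing_number_le:
  assumes "finite (pverts G)" "zero_forcing_set G Z"
  shows "zero_forcing_number G \<le> card Z"
  unfolding zero_forcing_number_def
  using assms by (intro Min_le finite_zero_forcing_cards) auto

lemma zero_forcing_number_witness:
  assumes "finite (pverts G)"
  obtains Z where "zero_forcing_set G Z" "card Z = zero_forcing_number G"
proof -
  have "zero_forcing_number G \<in> {card Z | Z. zero_forcing_set G Z}"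
    unfolding zero_forcing_number_def
    using zero_forcing_set_pverts by (intro Min_in finite_zero_forcing_cards assms) blast
  then show thesis using that by force
qed

section \<open>Neighbours in connected graphs\<close>

lemma connected_neighbour:
  assumes "pair_graph G" "connected G" "v \<in> pverts G" "card (pverts G) \<noteq> 1"
  obtains u where "u \<in> pverts G" "u \<noteq> v" "(u, v) \<in> parcs G" "(v, u) \<in> parcs G"
proof -
  interpret G: pair_graph G by fact
  have "pverts G \<noteq> {v}" using assms(4) by auto
  then obtain w where w: "w \<in> pverts G" "w \<noteq> v" using assms(3) by blast
  \<comment> \<open>The first arc of a path from \<open>v\<close> to another vertex gives the
    neighbour.\<close>
  have "v \<rightarrow>\<^sup>*\<^bsub>with_proj G\<^esub> w"
    using G.symmetric_connected_imp_strongly_connected[OF G.sym_arcs] assms w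
    by (auto simp: strongly_connected_def)
  then obtain u where "v \<rightarrow>\<^bsub>with_proj G\<^esub> u"
    using w by (cases rule: pre_digraph.converse_reachable_cases) auto
  then have "(v, u) \<in> parcs G" by simp
  moreover from this have "(u, v) \<in> parcs G"
    by (simp add: G.arcs_symmetric)
  ultimately show thesis
    using that G.no_loops' G.in_arcsD1 by metis
qed

text \<open>When only \<open>v\<close> is white, any neighbour of \<open>v\<close> forces it. This
  serves the case of the lower bound where the other graph is a single vertex.\<close>

lemma zero_forcing_set_remove1:
  assumes "pair_graph G" "connected G" "v \<in> pverts G" "card (pverts G) \<noteq> 1"
  shows "zero_forcing_set G (pverts G - {v})"
proof (rule zero_forcing_setI)
  interpret G: pair_graph G by fact
  show "finite (pverts G)" by simp
  obtain u where u: "u \<in> pverts G" "u \<noteq> v" "(u, v) \<in> parcs G"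
    using connected_neighbour[OF assms] .
  fix S assume "pverts G - {v} \<subseteq> S" "S \<subset> pverts G"
  then have "S = pverts G - {v}" by blast
  then have "u \<in> S" "{w \<in> pverts G. (u, w) \<in> parcs G \<and> w \<notin> S} = {v}"
    using u assms(3) by auto
  then show "\<exists>u\<in>S. \<exists>v. {w \<in> pverts G. (u, w) \<in> parcs G \<and> w \<notin> S} = {v}"
    by blast
qed blast

section \<open>The join and its symmetry\<close>

lemma pverts_graph_join [simp]: "pverts (graph_join G H) = pverts G <+> pverts H"
  by (simp add: graph_join_def)

lemma parcs_graph_join [simp]:
  "(Inl a, Inl b) \<in> parcs (graph_join G H) \<longleftrightarrow> (a, b) \<in> parcs G"
  "(Inr c, Inr d) \<in> parcs (graph_join G H) \<longleftrightarrow> (c, d) \<in> parcs H"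
  "(Inl a, Inr d) \<in> parcs (graph_join G H) \<longleftrightarrow> a \<in> pverts G \<and> d \<in> pverts H"
  "(Inr c, Inl b) \<in> parcs (graph_join G H) \<longleftrightarrow> b \<in> pverts G \<and> c \<in> pverts H"
  by (auto simp: graph_join_def)

text \<open>The map \<open>case_sum Inr Inl\<close> is an isomorphism of the two joins. It lets
  later arguments assume that the first force comes from the left graph.\<close>

lemma zero_forcing_set_join_swap:
  assumes "finite (pverts G)" "finite (pverts H)" "zero_forcing_set (graph_join G H) Z"
  shows "zero_forcing_set (graph_join H G) (case_sum Inr Inl ` Z)" (is "zero_forcing_set _ (?sw ` Z)")
proof -
  let ?sw' = "case_sum Inr Inl :: 'b + 'a \<Rightarrow> 'a + 'b"
  have inv: "?sw (?sw' x) = x" "?sw' (?sw y) = y" for x y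
    by (cases x; simp) (cases y; simp)
  have verts: "?sw' x \<in> pverts (graph_join G H) \<longleftrightarrow> x \<in> pverts (graph_join H G)" for x
    by (cases x) auto
  have arcs: "(?sw' x, ?sw' y) \<in> parcs (graph_join G H) \<longleftrightarrow> (x, y) \<in> parcs (graph_join H G)" for x y
    by (cases x; cases y) auto
  have Z: "Z \<subseteq> pverts (graph_join G H)"
    using assms by (simp add: zero_forcing_set_def)
  have finJ: "finite (pverts (graph_join G H))" using assms by simp
  show ?thesis
  proof (rule zero_forcing_setI)
    show "finite (pverts (graph_join H G))" using assms by simp
    show "?sw ` Z \<subseteq> pverts (graph_join H G)"
    proof (rule image_subsetI)
      show "?sw x \<in> pverts (graph_join H G)" if "x \<in> Z" for x
        using verts[of "?sw x"] subsetD[OF Z that] unfolding inv by blast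
    qed
    \<comment> \<open>A state of the swapped join is pulled back along \<open>?sw'\<close>; the
      force found there is pushed forward along \<open>?sw\<close>.\<close>
    fix S assume S: "?sw ` Z \<subseteq> S" "S \<subset> pverts (graph_join H G)"
    have mem: "?sw' w \<in> ?sw' ` S \<longleftrightarrow> w \<in> S" for w
      using inj_image_mem_iff[OF inj_on_inverseI[of _ ?sw ?sw'], OF inv(1)] .
    have "Z \<subseteq> ?sw' ` S"
    proof
      show "x \<in> ?sw' ` S" if "x \<in> Z" for x
        using imageI[of "?sw x" S ?sw'] S(1) that unfolding inv by blast
    qed
    moreover have "?sw' ` S \<subset> pverts (graph_join G H)"
    proof -
      obtain x where "x \<in> pverts (graph_join H G)" "x \<notin> S" using S by blast
      then have "?sw' x \<in> pverts (graph_join G H)" "?sw' x \<notin> ?sw' ` S"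
        using verts mem by blast+
      moreover have "?sw' ` S \<subseteq> pverts (graph_join G H)" using S verts by blast
      ultimately show ?thesis by blast
    qed
    ultimately obtain u v where uv: "u \<in> ?sw' ` S"
      "{w \<in> pverts (graph_join G H). (u, w) \<in> parcs (graph_join G H) \<and> w \<notin> ?sw' ` S} = {v}"
      by (rule zero_forcing_setE[OF finJ assms(3)])
    have "?sw u \<in> S" using uv(1) mem[of "?sw u"] unfolding inv by blast
    moreover have "{w \<in> pverts (graph_join H G). (?sw u, w) \<in> parcs (graph_join H G) \<and> w \<notin> S} = {?sw v}"
      (is "?N = _")
    proof -
      have "w \<in> ?N \<longleftrightarrow> ?sw' w \<in> {v}" for w
        unfolding uv(2)[symmetric] using verts[of w] arcs[of "?sw u" w] mem[of w] inv(2)[of u]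
        by (simp del: pverts_graph_join)
      moreover have "?sw' w \<in> {v} \<longleftrightarrow> w \<in> {?sw v}" for w
        using inv(1)[of w] inv(2)[of v] by auto
      ultimately show ?thesis by blast
    qed
    ultimately show "\<exists>u\<in>S. \<exists>v. {w \<in> pverts (graph_join H G). (u, w) \<in> parcs (graph_join H G) \<and> w \<notin> S} = {v}"
      by blast
  qed
qed

lemma zero_forcing_number_join_swap:
  assumes "finite (pverts G)" "finite (pverts H)"
  shows "zero_forcing_number (graph_join H G) \<le> zero_forcing_number (graph_join G H)"
proof -
  obtain Z where Z: "zero_forcing_set (graph_join G H) Z" "card Z = zero_forcing_number (graph_join G H)"
    using zero_forcing_number_witness[of "graph_join G H"] assms by auto
  have "Z \<subseteq> pverts (graph_join G H)" using Z by (simp add: zero_forcing_set_def)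
  then have "finite Z" using assms finite_subset by fastforce
  have "zero_forcing_number (graph_join H G) \<le> card (case_sum Inr Inl ` Z)"
    using zero_forcing_set_join_swap[OF assms Z(1)] assms by (intro zero_forcing_number_le) auto
  also have "\<dots> \<le> card Z" using \<open>finite Z\<close> by (rule card_image_le)
  finally show ?thesis using Z by simp
qed

section \<open>Upper bound\<close>

lemma zero_forcing_set_join:
  assumes "finite (pverts G)" "finite (pverts H)" "zero_forcing_set G Z"
  shows "zero_forcing_set (graph_join G H) (Z <+> pverts H)"
proof (rule zero_forcing_setI)
  show "finite (pverts (graph_join G H))" using assms by simp
  show "Z <+> pverts H \<subseteq> pverts (graph_join G H)"
    using assms by (auto simp: zero_forcing_set_def)
  fix S assume S: "Z <+> pverts H \<subseteq> S" "S \<subset> pverts (graph_join G H)"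
  have "Z \<subseteq> Inl -` S" "Inl -` S \<subset> pverts G" using S by auto
  then obtain u v where uv: "u \<in> Inl -` S" "{w \<in> pverts G. (u, w) \<in> parcs G \<and> w \<notin> Inl -` S} = {v}"
    by (rule zero_forcing_setE[OF assms(1,3)])
  \<comment> \<open>As all of \<open>H\<close> is black, a vertex of \<open>G\<close> has the same
    white neighbours in the join as in \<open>G\<close>.\<close>
  have "{w \<in> pverts (graph_join G H). (Inl u, w) \<in> parcs (graph_join G H) \<and> w \<notin> S} =
      Inl ` {w \<in> pverts G. (u, w) \<in> parcs G \<and> w \<notin> Inl -` S}"
    using S by auto
  then show "\<exists>u\<in>S. \<exists>v. {w \<in> pverts (graph_join G H). (u, w) \<in> parcs (graph_join G H) \<and> w \<notin> S} = {v}"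
    using uv by auto
qed

lemma zero_forcing_number_join_le:
  assumes "finite (pverts G)" "finite (pverts H)"
  shows "zero_forcing_number (graph_join G H) \<le> card (pverts H) + zero_forcing_number G"
proof -
  obtain Z where Z: "zero_forcing_set G Z" "card Z = zero_forcing_number G"
    using zero_forcing_number_witness assms by metis
  have "finite Z" using Z assms by (auto simp: zero_forcing_set_def intro: finite_subset)
  have "zero_forcing_number (graph_join G H) \<le> card (Z <+> pverts H)"
    using zero_forcing_set_join[OF assms Z(1)] assms by (intro zero_forcing_number_le) auto
  then show ?thesis using Z \<open>finite Z\<close> assms by (simp add: card_Plus)
qed

section \<open>Lower bound\<close>

lemma zero_forcing_set_of_join:
  assumes G: "pair_graph G" "connected G" "card (pverts G) \<noteq> 1" and "finite (pverts H)"
    and zf: "zero_forcing_set (graph_join G H) Z" and H: "Inr ` pverts H \<subseteq> Z"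
  shows "zero_forcing_set G (Inl -` Z)"
proof (rule zero_forcing_setI)
  interpret G: pair_graph G by fact
  show "finite (pverts G)" by simp
  have finJ: "finite (pverts (graph_join G H))" using assms by simp
  have Z: "Z \<subseteq> pverts (graph_join G H)" using zf by (simp add: zero_forcing_set_def)
  then show "Inl -` Z \<subseteq> pverts G" by auto
  fix S assume S: "Inl -` Z \<subseteq> S" "S \<subset> pverts G"
  \<comment> \<open>A state \<open>S\<close> of \<open>G\<close> is lifted to the join by blackening
    all of \<open>H\<close>; the join can still force there, and the forced vertex must lie in
    \<open>G\<close>.\<close>
  have "Z \<subseteq> S <+> pverts H"
  proof
    fix x assume "x \<in> Z"
    then show "x \<in> S <+> pverts H" using S Z by (cases x) auto
  qed
  moreover have "S <+> pverts H \<subset> pverts (graph_join G H)" using S by auto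
  ultimately obtain u v where uv: "u \<in> S <+> pverts H"
    "{w \<in> pverts (graph_join G H). (u, w) \<in> parcs (graph_join G H) \<and> w \<notin> S <+> pverts H} = {v}"
      (is "?N = _")
    by (rule zero_forcing_setE[OF finJ zf])
  obtain b where v: "v = Inl b" "b \<in> pverts G" "b \<notin> S"
    using uv(2) by (cases v) auto
  show "\<exists>u\<in>S. \<exists>v. {w \<in> pverts G. (u, w) \<in> parcs G \<and> w \<notin> S} = {v}"
  proof (cases u)
    case (Inl a)
    have "{w \<in> pverts G. (a, w) \<in> parcs G \<and> w \<notin> S} = Inl -` ?N"
      using Inl by auto
    also have "\<dots> = {b}" unfolding uv(2) v by auto
    finally show ?thesis using Inl uv(1) by auto
  next
    case (Inr h)
    \<comment> \<open>A vertex of \<open>H\<close> sees all of \<open>G\<close>, so having one white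
      neighbour means that \<open>G\<close> has one white vertex.\<close>
    have "pverts G - S = Inl -` ?N" using Inr uv(1) by auto
    also have "\<dots> = {b}" unfolding uv(2) v by auto
    finally have white: "pverts G - S = {b}" .
    obtain c where c: "c \<in> pverts G" "c \<noteq> b" "(c, b) \<in> parcs G"
      using connected_neighbour[OF G(1,2) v(2) G(3)] .
    then have "c \<in> S" "{w \<in> pverts G. (c, w) \<in> parcs G \<and> w \<notin> S} = {b}"
      using white by auto
    then show ?thesis by blast
  qed
qed

lemma card_join_set:
  assumes "finite Z"
  shows "card Z = card (Inl -` Z) + card (Inr -` Z)"
proof -
  have "finite (Inl -` Z)" "finite (Inr -` Z)"
    using assms by (auto intro: finite_vimageI)
  moreover have "Z = Inl -` Z <+> Inr -` Z"
  proof (rule set_eqI)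
    show "x \<in> Z \<longleftrightarrow> x \<in> Inl -` Z <+> Inr -` Z" for x by (cases x) auto
  qed
  ultimately show ?thesis by (metis card_Plus)
qed

text \<open>The forcing vertex is adjacent to the whole opposite side, so that side has at most one
  white vertex. Forces from the right graph are reduced to this lemma by swapping the sides.\<close>

lemma join_first_force_bound:
  assumes G: "pair_graph G" "connected G" and H: "pair_graph H" "connected H"
    and not_both: "\<not> (card (pverts G) = 1 \<and> card (pverts H) = 1)"
    and zf: "zero_forcing_set (graph_join G H) Z" and a: "Inl a \<in> Z"
    and N: "{w \<in> pverts (graph_join G H). (Inl a, w) \<in> parcs (graph_join G H) \<and> w \<notin> Z} = {v}"
  shows "min (card (pverts H) + zero_forcing_number G) (card (pverts G) + zero_forcing_number H)
    \<le> card Z"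
proof -
  interpret G: pair_graph G by fact
  interpret H: pair_graph H by fact
  have Z: "Z \<subseteq> pverts (graph_join G H)" using zf by (simp add: zero_forcing_set_def)
  have finJ: "finite (pverts (graph_join G H))" by simp
  have finZ: "finite Z" using Z finJ by (rule finite_subset)
  note card = card_join_set[OF finZ]
  have aG: "a \<in> pverts G" using Z a by auto
  have v: "v \<in> pverts (graph_join G H)" "(Inl a, v) \<in> parcs (graph_join G H)" "v \<notin> Z"
    using N by blast+
  have white: "w = v" if "w \<in> pverts (graph_join G H)" "(Inl a, w) \<in> parcs (graph_join G H)" "w \<notin> Z" for w
    using that N by blast
  have whiteH: "Inr h = v" if "h \<in> pverts H" "Inr h \<notin> Z" for h
    using white[of "Inr h"] that aG by auto
  show ?thesis
  proof (cases v)
    case (Inl b)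
    have b: "b \<in> pverts G" "(a, b) \<in> parcs G" using v Inl by auto
    have "Inr ` pverts H \<subseteq> Z" using whiteH Inl by blast
    moreover have "card (pverts G) \<noteq> 1"
    proof
      assume "card (pverts G) = 1"
      then have "a = b" using aG b by (auto simp: card_1_singleton_iff)
      then show False using b G.no_loops' by blast
    qed
    ultimately have "zero_forcing_set G (Inl -` Z)"
      using zero_forcing_set_of_join[OF G _ H.pair_finite_verts zf] by simp
    then have "zero_forcing_number G \<le> card (Inl -` Z)"
      by (simp add: zero_forcing_number_le)
    moreover have "Inr -` Z = pverts H" using \<open>Inr ` pverts H \<subseteq> Z\<close> Z by auto
    ultimately show ?thesis using card by simp
  next
    case (Inr h)
    have h: "h \<in> pverts H" using v Inr by auto
    have blackH: "Inr -` Z = pverts H - {h}"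
      using whiteH v Inr Z by auto
    have nbr: "Inl c \<in> Z" if "(a, c) \<in> parcs G" for c
      using white[of "Inl c"] that G.in_arcsD2[OF that] Inr by auto
    have cardH: "card (pverts H) = Suc (card (Inr -` Z))"
      using card.remove[OF H.pair_finite_verts h] blackH by simp
    show ?thesis
    proof (cases "card (pverts G) = 1")
      case True
      \<comment> \<open>Here \<open>Z\<close> misses only \<open>v\<close>, so it has
        \<open>card (pverts G) + card (pverts H) - 1\<close> elements.\<close>
      then have "pverts G = {a}" using aG by (auto simp: card_1_singleton_iff)
      then have "Inl -` Z = pverts G" using a Z by auto
      moreover have "zero_forcing_number H \<le> card (pverts H - {h})"
        using zero_forcing_set_remove1[OF H h] not_both True by (simp add: zero_forcing_number_le)
      ultimately show ?thesis using card blackH by simp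
    next
      case False
      obtain c where c: "c \<in> pverts G" "c \<noteq> a" "(a, c) \<in> parcs G"
        using connected_neighbour[OF G aG False] .
      \<comment> \<open>Adding \<open>v\<close> makes \<open>H\<close> entirely black without
        changing the part of the set in \<open>G\<close>.\<close>
      have "zero_forcing_set G (Inl -` insert v Z)"
      proof (rule zero_forcing_set_of_join)
        show "zero_forcing_set (graph_join G H) (insert v Z)"
          using v Z by (intro zero_forcing_set_mono[OF finJ zf]) auto
        show "Inr ` pverts H \<subseteq> insert v Z" using whiteH by blast
      qed (use G False in auto)
      then have zfG: "zero_forcing_set G (Inl -` Z)" using Inr by (simp add: vimage_def)
      \<comment> \<open>While \<open>c\<close> is white, \<open>a\<close> can force it, since
        \<open>a\<close> and its other neighbours in \<open>G\<close> are black. The vertex saved in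
        \<open>G\<close> makes up for the one white vertex \<open>h\<close> of
        \<open>H\<close>.\<close>
      have "zero_forcing_set G (Inl -` Z - {c})"
      proof (rule zero_forcing_setI)
        show "Inl -` Z - {c} \<subseteq> pverts G" using Z by auto
        fix S assume S: "Inl -` Z - {c} \<subseteq> S" "S \<subset> pverts G"
        show "\<exists>u\<in>S. \<exists>v. {w \<in> pverts G. (u, w) \<in> parcs G \<and> w \<notin> S} = {v}"
        proof (cases "c \<in> S")
          case True
          then have "Inl -` Z \<subseteq> S" using S by auto
          then obtain u v where "u \<in> S" "{w \<in> pverts G. (u, w) \<in> parcs G \<and> w \<notin> S} = {v}"
            using zero_forcing_setE[OF G.pair_finite_verts zfG _ S(2)] by blast
          then show ?thesis by blast
        next
          case False
          then have "{w \<in> pverts G. (a, w) \<in> parcs G \<and> w \<notin> S} = {c}"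
            using c S nbr by auto
          moreover have "a \<in> S" using S a c by auto
          ultimately show ?thesis by blast
        qed
      qed simp
      then have "zero_forcing_number G \<le> card (Inl -` Z - {c})"
        by (simp add: zero_forcing_number_le)
      moreover have "card (Inl -` Z) = Suc (card (Inl -` Z - {c}))"
        using nbr[OF c(3)] finZ by (intro card.remove) (auto intro: finite_vimageI)
      ultimately show ?thesis using card cardH by simp
    qed
  qed
qed

theorem theorem5p12:
  fixes G :: "'a pair_pre_digraph" and H :: "'b pair_pre_digraph"
  assumes "pair_graph G" and "pair_graph H"
    and "connected G" and "connected H"
    and not_both_single: "\<not> (card (pverts G) = 1 \<and> card (pverts H) = 1)"
  shows "zero_forcing_number (graph_join G H) =
    min (card (pverts H) + zero_forcing_number G) (card (pverts G) + zero_forcing_number H)"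
proof -
  interpret G: pair_graph G by fact
  interpret H: pair_graph H by fact
  let ?m = "min (card (pverts H) + zero_forcing_number G) (card (pverts G) + zero_forcing_number H)"
  have fin: "finite (pverts G)" "finite (pverts H)" "finite (pverts (graph_join G H))"
    by simp_all
  have "zero_forcing_number (graph_join G H) \<le> ?m"
    using zero_forcing_number_join_le[of G H] zero_forcing_number_join_le[of H G]
      zero_forcing_number_join_swap[of H G] by simp
  moreover have "?m \<le> zero_forcing_number (graph_join G H)"
  proof -
    obtain Z where zf: "zero_forcing_set (graph_join G H) Z"
      and card: "card Z = zero_forcing_number (graph_join G H)"
      using zero_forcing_number_witness[OF fin(3)] .
    have Z: "Z \<subseteq> pverts (graph_join G H)" using zf by (simp add: zero_forcing_set_def)
    have finZ: "finite Z" using Z fin(3) by (rule finite_subset)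
    have "?m \<le> card Z"
    proof (cases "Z = pverts (graph_join G H)")
      \<comment> \<open>With everything black there is no first force, and
        \<open>zero_forcing_number G \<le> card (pverts G)\<close> suffices.\<close>
      case True
      then have "card Z = card (pverts G) + card (pverts H)" by (simp add: card_Plus)
      then show ?thesis
        using zero_forcing_number_le[OF _ zero_forcing_set_pverts, of G] by simp
    next
      case False
      \<comment> \<open>The no-stalling condition at \<open>S = Z\<close> yields the first
        force.\<close>
      then obtain u v where uv: "u \<in> Z"
        "{w \<in> pverts (graph_join G H). (u, w) \<in> parcs (graph_join G H) \<and> w \<notin> Z} = {v}"
        using zero_forcing_setE[OF fin(3) zf] Z by blast
      show ?thesis
      proof (cases u)
        case (Inl a)
        show ?thesis
          using join_first_force_bound[OF assms(1,3,2,4,5) zf] uv unfolding Inl by blast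
      next
        case (Inr h)
        let ?sw = "case_sum Inr Inl :: 'a + 'b \<Rightarrow> 'b + 'a"
        have mem: "Inl y \<in> ?sw ` A \<longleftrightarrow> Inr y \<in> A" "Inr x \<in> ?sw ` A \<longleftrightarrow> Inl x \<in> A" for x y A
          by (force split: sum.splits)+
        \<comment> \<open>The swap carries the white neighbours of \<open>u\<close> to those of
          \<open>Inl h\<close>, so the first-force bound applies with \<open>G\<close> and
          \<open>H\<close> exchanged.\<close>
        have "{w \<in> pverts (graph_join H G). (Inl h, w) \<in> parcs (graph_join H G) \<and> w \<notin> ?sw ` Z}
            = ?sw ` {w \<in> pverts (graph_join G H). (u, w) \<in> parcs (graph_join G H) \<and> w \<notin> Z}"
          (is "?L = ?R")
        proof (rule set_eqI)
          show "x \<in> ?L \<longleftrightarrow> x \<in> ?R" for x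
            unfolding Inr by (cases x) (simp_all only: mem mem_Collect_eq, auto)
        qed
        then have "{w \<in> pverts (graph_join H G). (Inl h, w) \<in> parcs (graph_join H G) \<and> w \<notin> ?sw ` Z}
            = {?sw v}"
          unfolding uv(2) by simp
        moreover have "Inl h \<in> ?sw ` Z" using uv(1) Inr mem by simp
        moreover have "\<not> (card (pverts H) = 1 \<and> card (pverts G) = 1)"
          using not_both_single by blast
        ultimately have "?m \<le> card (?sw ` Z)"
          using join_first_force_bound[OF assms(2,4,1,3) _ zero_forcing_set_join_swap[OF fin(1,2) zf]]
          by (subst min.commute) blast
        also have "\<dots> \<le> card Z" using finZ by (rule card_image_le)
        finally show ?thesis .
      qed
    qed
    then show ?thesis using card by simp
  qed
  ultimately show ?thesis by (rule antisym)
qed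

end
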